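(* Let $G$ and $G'$ be connected graphs such that $|V(G)|=n$ and $|V(G')|=n-\ell$ for some integer $\ell$ with $1\le \ell<n$. Then $q(G\vee G')\le 2+\ell$.
   Context: All graphs are finite and simple. For a graph $H$ on $m$ vertices, $\mathcal{S}(H)$ is the set of real symmetric $m\times m$ matrices whose off-diagonal entry in position $(i,j)$ is nonzero if and only if $ij$ is an edge of $H$ (diagonal unrestricted); $q(A)$ denotes the number of distinct eigenvalues of a matrix $A$ and $q(H)=\min\{q(A):A\in\mathcal{S}(H)\}$. The join $G\vee G'$ of disjoint graphs $G,G'$ has vertex set $V(G)\cup V(G')$ and edge set $E(G)\cup E(G')\cup\{vv': v\in V(G),v'\in V(G')\}$. *)

theory Defs
  imports "HOL-Analysis.Analysis"
begin

text \<open>A graph whose vertices are the elements of the finite type \<open>'v\<close> is given by its symmetric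
  irreflexive adjacency relation, so each edge \<open>uv\<close> is recorded as both \<open>(u, v)\<close> and \<open>(v, u)\<close>.
  Matrices of a graph are indexed by its vertices.\<close>

definition simple_graph :: "('v::finite \<times> 'v) set \<Rightarrow> bool" where
  "simple_graph E \<longleftrightarrow> sym E \<and> irrefl E"

definition connected_graph :: "('v::finite \<times> 'v) set \<Rightarrow> bool" where
  "connected_graph E \<longleftrightarrow> (\<forall>u v. (u, v) \<in> E\<^sup>*)"

text \<open>The sum type makes the two vertex sets disjoint.\<close>

definition graph_join ::
    "('a::finite \<times> 'a) set \<Rightarrow> ('b::finite \<times> 'b) set \<Rightarrow> (('a + 'b) \<times> ('a + 'b)) set" where
  "graph_join E E' =
     {(Inl u, Inl v) |u v. (u, v) \<in> E} \<union> {(Inr u, Inr v) |u v. (u, v) \<in> E'} \<union>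
     {(Inl u, Inr v) |u v. True} \<union> {(Inr v, Inl u) |u v. True}"

definition graph_matrices :: "('v::finite \<times> 'v) set \<Rightarrow> (real^'v^'v) set" where
  "graph_matrices E =
     {A. transpose A = A \<and> (\<forall>i j. i \<noteq> j \<longrightarrow> (A $ i $ j \<noteq> 0 \<longleftrightarrow> (i, j) \<in> E))}"

definition eigenvalues :: "real^'v^'v \<Rightarrow> real set" where
  "eigenvalues A = {c. \<exists>x. x \<noteq> 0 \<and> A *v x = c *s x}"

definition q_matrix :: "real^'v^'v \<Rightarrow> nat" where
  "q_matrix A = card (eigenvalues A)"

text \<open>On \<open>nat\<close>, the infimum of a nonempty set is its minimum; see \<open>q_graph_attained\<close>.\<close>

definition q_graph :: "('v::finite \<times> 'v) set \<Rightarrow> nat" where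
  "q_graph E = (INF A\<in>graph_matrices E. q_matrix A)"

lemma simple_graph_join:
  "simple_graph E \<Longrightarrow> simple_graph E' \<Longrightarrow> simple_graph (graph_join E E')"
  by (auto simp: simple_graph_def graph_join_def sym_def irrefl_def)

lemma finite_eigenvalues:
  fixes A :: "real^'v^'v"
  assumes "transpose A = A"
  shows "finite (eigenvalues A)"
proof -
  have "\<forall>c\<in>eigenvalues A. \<exists>x. x \<noteq> 0 \<and> A *v x = c *s x"
    by (simp add: eigenvalues_def)
  then obtain f where f: "\<And>c. c \<in> eigenvalues A \<Longrightarrow> f c \<noteq> 0 \<and> A *v f c = c *s f c"
    by metis
  have orth: "f c \<bullet> f d = 0" if "c \<in> eigenvalues A" "d \<in> eigenvalues A" "c \<noteq> d" for c d
  proof -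
    have "(A *v f c) \<bullet> f d = f c \<bullet> (A *v f d)"
      using assms by (metis dot_lmul_matrix vector_transpose_matrix)
    then have "c * (f c \<bullet> f d) = d * (f c \<bullet> f d)"
      using f that by (simp add: scalar_mult_eq_scaleR)
    then show ?thesis using that by simp
  qed
  have inj: "inj_on f (eigenvalues A)"
    using orth f by (metis inj_onI inner_eq_zero_iff)
  have "pairwise orthogonal (f ` eigenvalues A)"
    using orth by (auto simp: pairwise_def orthogonal_def)
  moreover have "0 \<notin> f ` eigenvalues A"
    using f by force
  ultimately have "independent (f ` eigenvalues A)"
    by (rule pairwise_orthogonal_independent)
  then show ?thesis
    using inj finiteI_independent finite_image_iff by blast
qed

lemma graph_matrices_nonempty:
  assumes "simple_graph E"
  shows "graph_matrices E \<noteq> {}"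
proof -
  have "(\<chi> i j. if (i, j) \<in> E then 1 else 0) \<in> graph_matrices E"
    using assms
    by (auto simp: graph_matrices_def simple_graph_def transpose_def vec_eq_iff sym_def)
  then show ?thesis by blast
qed

lemma q_graph_attained:
  assumes "simple_graph E"
  shows "\<exists>A\<in>graph_matrices E. q_graph E = q_matrix A"
  using Inf_nat_def1[of "q_matrix ` graph_matrices E"] graph_matrices_nonempty[OF assms]
  by (auto simp: q_graph_def)

end

theory Submission
  imports Defs
begin

text \<open>Place both graphs on the vertices of \<open>G\<close>, leaving a vertex \<open>a0\<close> outside \<open>G'\<close>. Small
  perturbations of diagonal matrices give a matrix \<open>A\<close> of \<open>G\<close> and a matrix \<open>C\<close> of \<open>G'\<close> (padded with
  isolated vertices), with eigenbases close to the standard basis and with the eigenvalues \<open>\<mu>\<close> of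
  \<open>C\<close> strictly interlacing the numbers \<open>\<delta> = c - \<lambda>\<close>, where \<open>\<lambda>\<close> are the eigenvalues of \<open>A\<close>.
  Interlacing yields a vector \<open>z\<close> such that \<open>diag \<delta> + z z\<^sup>T\<close> has the spectrum \<open>\<mu>\<close>. Hence there are
  square matrices with \<open>X X\<^sup>T = A\<close>, \<open>Y Y\<^sup>T = C\<close> and \<open>X\<^sup>T X + Y\<^sup>T Y = c I + z z\<^sup>T\<close>, and in the limit of
  vanishing perturbation the entries of \<open>X Y\<^sup>T\<close> are those of a Cauchy-like matrix, so they do not vanish.
  The row of \<open>Y\<close> at \<open>a0\<close> is zero because \<open>C\<close> has a zero diagonal entry there. Deleting this
  row and the other \<open>l - 1\<close> rows outside \<open>G'\<close> changes \<open>c I\<close> by rank at most \<open>l\<close> in total, so the Gram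
  matrix of the remaining rows of \<open>X\<close> and \<open>Y\<close> has at most \<open>l\<close> eigenvalues besides \<open>0\<close> and \<open>c\<close>.\<close>

section \<open>Gram matrices and orthonormal eigenbases\<close>

lemma eigenvectors_orthogonal:
  fixes A :: "real^'a^'a"
  assumes "transpose A = A" "A *v x = s *\<^sub>R x" "A *v y = t *\<^sub>R y" "s \<noteq> t"
  shows "x \<bullet> y = 0"
proof -
  have "(A *v x) \<bullet> y = x \<bullet> (A *v y)"
    using assms(1) by (metis dot_lmul_matrix vector_transpose_matrix)
  then show ?thesis using assms(2-) by simp
qed

text \<open>A nonzero eigenvalue of a Gram matrix is also one of the frame operator, the sum of the
  rank-one maps of the vectors \<open>k q\<close>. Modulo \<open>span B\<close> that operator is
  multiplication by \<open>c\<close>, so its eigenvectors for eigenvalues other than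
  \<open>c\<close> lie in \<open>span B\<close>. Distinct eigenvalues give orthogonal eigenvectors,
  hence at most \<open>card B\<close> of them.\<close>

lemma gram_eigenvalues_card:
  fixes k :: "'m::finite \<Rightarrow> real^'n"
  assumes B: "finite B" "card B \<le> l"
    and span: "\<And>v. (\<Sum>q\<in>UNIV. (k q \<bullet> v) *\<^sub>R k q) - c *\<^sub>R v \<in> span B"
  shows "q_matrix (\<chi> p q. k p \<bullet> k q) \<le> 2 + l"
proof -
  define M :: "real^'m^'m" where "M = (\<chi> p q. k p \<bullet> k q)"
  define K where "K x = (\<Sum>p\<in>UNIV. x $ p *\<^sub>R k p)" for x :: "real^'m"
  have M: "(M *v x) $ q = k q \<bullet> K x" for x q
    by (simp add: M_def K_def matrix_vector_mult_def inner_sum_right mult.commute)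
  have inner_K: "K x \<bullet> K y = x \<bullet> (M *v y)" for x y
    by (simp add: K_def[of x] inner_sum_left M[of y] inner_vec_def[of x])
  \<comment> \<open>Without \<open>0\<close>, the map \<open>K\<close> does not kill the chosen
    eigenvectors; without \<open>c\<close>, division by \<open>t - c\<close> is possible.\<close>
  define S where "S = eigenvalues M - {0, c}"
  have "\<forall>t\<in>S. \<exists>x. x \<noteq> 0 \<and> M *v x = t *s x"
    by (simp add: eigenvalues_def S_def)
  then obtain f where f: "\<And>t. t \<in> S \<Longrightarrow> f t \<noteq> 0 \<and> M *v f t = t *s f t"
    by metis
  have MT: "transpose M = M"
    by (simp add: M_def transpose_def inner_commute)
  have orth: "f s \<bullet> f t = 0" if "s \<in> S" "t \<in> S" "s \<noteq> t" for s t
    using eigenvectors_orthogonal[OF MT] f that by (simp add: scalar_mult_eq_scaleR)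
  have Kf: "K (f s) \<bullet> K (f t) = t * (f s \<bullet> f t)" if "t \<in> S" for s t
    using f[OF that] by (simp add: inner_K scalar_mult_eq_scaleR)
  have nz: "K (f t) \<noteq> 0" if "t \<in> S" for t
    using Kf[OF that, of t] f[OF that] that by (auto simp: S_def)
  have inj: "inj_on (\<lambda>t. K (f t)) S"
  proof (rule inj_onI, rule ccontr)
    fix s t assume st: "s \<in> S" "t \<in> S" "K (f s) = K (f t)" "s \<noteq> t"
    then have "K (f t) \<bullet> K (f t) = 0" using Kf[OF st(2), of s] orth by simp
    then show False using nz[OF st(2)] by simp
  qed
  have "pairwise orthogonal ((\<lambda>t. K (f t)) ` S)"
    using orth Kf by (auto simp: pairwise_def orthogonal_def)
  moreover have "0 \<notin> (\<lambda>t. K (f t)) ` S"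
    using nz by force
  ultimately have ind: "independent ((\<lambda>t. K (f t)) ` S)"
    by (rule pairwise_orthogonal_independent)
  have "K (f t) \<in> span B" if "t \<in> S" for t
  proof -
    \<comment> \<open>\<open>K\<close> carries the eigenvector \<open>f t\<close> of
      \<open>M\<close> to an eigenvector of the frame operator with the same eigenvalue.\<close>
    have "k q \<bullet> K (f t) = t * f t $ q" for q
      using M[of "f t" q] f[OF that] by simp
    then have "(\<Sum>q\<in>UNIV. (k q \<bullet> K (f t)) *\<^sub>R k q) = t *\<^sub>R K (f t)"
      by (simp add: K_def[of "f t"] scaleR_sum_right)
    then have "(t - c) *\<^sub>R K (f t) \<in> span B"
      using span[of "K (f t)"] by (simp add: scaleR_left_diff_distrib)
    then have "(1 / (t - c)) *\<^sub>R (t - c) *\<^sub>R K (f t) \<in> span B"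
      by (rule span_mul)
    then show ?thesis using that by (simp add: S_def)
  qed
  then have "card ((\<lambda>t. K (f t)) ` S) \<le> card B"
    using independent_span_bound[OF B(1) ind] by blast
  then have "card S \<le> l"
    using card_image[OF inj] B(2) by simp
  moreover have "card (eigenvalues M) \<le> card {0, c} + card S"
  proof -
    have "card (eigenvalues M) \<le> card ({0, c} \<union> S)"
      using finite_eigenvalues[OF MT] by (intro card_mono) (auto simp: S_def)
    also have "\<dots> \<le> card {0, c} + card S" by (rule card_Un_le)
    finally show ?thesis .
  qed
  moreover have "card {0, c} \<le> 2" by (simp add: card_insert_if)
  ultimately show ?thesis by (simp add: q_matrix_def M_def)
qed

text \<open>A one-sided inverse of a square matrix is two-sided, so orthonormal rows force
  orthonormal columns.\<close>

lemma orthonormal_dual: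
  fixes u :: "'a::finite \<Rightarrow> real^'a"
  assumes "\<And>i j. u i \<bullet> u j = (if i = j then 1 else 0)"
  shows "(\<Sum>i\<in>UNIV. u i $ a * u i $ b) = (if a = b then 1 else 0)"
proof -
  define U :: "real^'a^'a" where "U = (\<chi> i. u i)"
  have "U ** transpose U = mat 1"
    using assms by (simp add: U_def matrix_matrix_mult_def transpose_def mat_def vec_eq_iff inner_vec_def)
  then have "transpose U ** U = mat 1"
    by (simp add: matrix_left_right_inverse)
  then show ?thesis
    by (simp add: U_def matrix_matrix_mult_def transpose_def mat_def vec_eq_iff)
qed

lemma orthonormal_eigen_decomposition:
  fixes A :: "real^'a^'a" and u :: "'a \<Rightarrow> real^'a"
  assumes "\<And>i j. u i \<bullet> u j = (if i = j then 1 else 0)"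
    and "\<And>i. A *v u i = t i *\<^sub>R u i"
  shows "A $ a $ b = (\<Sum>i\<in>UNIV. t i * u i $ a * u i $ b)"
proof -
  have "(\<Sum>i\<in>UNIV. t i * u i $ a * u i $ b) = (\<Sum>i\<in>UNIV. (A *v u i) $ a * u i $ b)"
    by (simp add: assms(2))
  also have "\<dots> = (\<Sum>i\<in>UNIV. \<Sum>c\<in>UNIV. A $ a $ c * (u i $ c * u i $ b))"
    by (simp add: matrix_vector_mult_def sum_distrib_right mult.assoc)
  also have "\<dots> = (\<Sum>c\<in>UNIV. A $ a $ c * (\<Sum>i\<in>UNIV. u i $ c * u i $ b))"
    by (subst sum.swap) (simp add: sum_distrib_left)
  also have "\<dots> = A $ a $ b"
    by (simp add: orthonormal_dual[OF assms(1)] if_distrib cong: if_cong)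
  finally show ?thesis by simp
qed

section \<open>Partial fractions and the secular equation\<close>

text \<open>Minus the residue at \<open>d i\<close> of the rational function with zeros \<open>m\<close> and poles \<open>d\<close>.\<close>

definition secular_weight :: "('a::finite \<Rightarrow> real) \<Rightarrow> ('a \<Rightarrow> real) \<Rightarrow> 'a \<Rightarrow> real" where
  "secular_weight d m i = (m i - d i) * (\<Prod>k\<in>UNIV-{i}. (d i - m k) / (d i - d k))"

text \<open>For the monic polynomials \<open>P\<close> with zeros \<open>m\<close> and
  \<open>Q\<close> with zeros \<open>d\<close>, partial fractions give P/Q = 1 - (sum of w i / (x -
  d i)). Evaluating at the zero \<open>m j\<close> of \<open>P\<close> yields the claim.\<close>

lemma secular_equation:
  fixes d m :: "'a::finite \<Rightarrow> real"
  assumes "inj d" and ne: "\<And>i. m j \<noteq> d i"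
  shows "(\<Sum>i\<in>UNIV. secular_weight d m i / (m j - d i)) = 1"
proof -
  define w where "w = secular_weight d m"
  define P where "P = (\<Prod>k\<in>UNIV. [:- m k, 1:])"
  define Q where "Q = (\<Prod>k\<in>UNIV. [:- d k, 1:])"
  define L where "L i = (\<Prod>k\<in>UNIV-{i}. [:- d k, 1:])" for i
  \<comment> \<open>The partial fraction identity, cleared of denominators, says that
    \<open>F\<close> is zero. The leading terms of \<open>Q\<close> and \<open>P\<close> cancel, so
    \<open>F\<close> has degree below \<open>CARD('a)\<close>, yet it vanishes at the
    \<open>CARD('a)\<close> distinct points \<open>d i\<close>.\<close>
  define F where "F = Q - P - (\<Sum>i\<in>UNIV. smult (w i) (L i))"
  have monic: "degree (\<Prod>k\<in>I. [:- f k, 1:]) = card I \<and> lead_coeff (\<Prod>k\<in>I. [:- f k, 1:]) = 1"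
    for f :: "'a \<Rightarrow> real" and I
  proof
    show deg: "degree (\<Prod>k\<in>I. [:- f k, 1:]) = card I"
      by (simp add: degree_prod_eq_sum_degree)
    show "lead_coeff (\<Prod>k\<in>I. [:- f k, 1:]) = 1"
      by (simp only: lead_coeff_prod) simp
  qed
  have dQP: "degree (Q - P) < CARD('a)"
  proof -
    have "coeff (Q - P) (CARD('a)) = 0" "degree (Q - P) \<le> CARD('a)"
      using monic[of m UNIV] monic[of d UNIV]
      by (auto simp: P_def Q_def intro!: degree_diff_le)
    then show ?thesis
      by (metis eq_zero_or_degree_less degree_0 zero_less_card_finite)
  qed
  have dL: "degree (L i) < CARD('a)" for i
    using monic[of d "UNIV - {i}"] by (simp add: L_def card_Diff_singleton)
  have dF: "degree F < CARD('a)"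
    unfolding F_def
    using dL by (intro degree_diff_less[OF dQP] degree_sum_less) auto
  have Ld: "poly (L i) (d k) = (if i = k then (\<Prod>k\<in>UNIV-{i}. d i - d k) else 0)" for i k
    by (auto simp: L_def poly_prod)
  have "poly F (d i) = 0" for i
  proof -
    have "poly Q (d i) = 0" by (auto simp: Q_def poly_prod)
    moreover have "poly P (d i) = (d i - m i) * (\<Prod>k\<in>UNIV-{i}. d i - m k)"
      by (simp add: P_def poly_prod prod.remove[of UNIV i] algebra_simps)
    moreover have "(\<Sum>k\<in>UNIV. w k * poly (L k) (d i)) = w i * (\<Prod>k\<in>UNIV-{i}. d i - d k)"
      by (simp add: Ld if_distrib cong: if_cong)
    moreover have "w i * (\<Prod>k\<in>UNIV-{i}. d i - d k) = (m i - d i) * (\<Prod>k\<in>UNIV-{i}. d i - m k)"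
    proof -
      have "(\<Prod>k\<in>UNIV-{i}. d i - d k) \<noteq> 0" using assms(1) by (auto dest: injD)
      then show ?thesis by (simp add: w_def secular_weight_def prod_dividef)
    qed
    ultimately show ?thesis by (simp add: F_def poly_sum algebra_simps)
  qed
  then have sub: "range d \<subseteq> {x. poly F x = 0}" by auto
  have "F = 0"
  proof (rule ccontr)
    assume "F \<noteq> 0"
    then have "card (range d) \<le> degree F"
      using card_mono[OF poly_roots_finite sub] card_poly_roots_bound[of F] by fastforce
    then show False using dF card_image[OF assms(1)] by simp
  qed
  then have "poly F (m j) = 0" by simp
  moreover have "poly P (m j) = 0" by (auto simp: P_def poly_prod)
  ultimately have *: "poly Q (m j) = (\<Sum>i\<in>UNIV. w i * poly (L i) (m j))"
    by (simp add: F_def poly_sum)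
  have Q0: "poly Q (m j) \<noteq> 0" using ne by (simp add: Q_def poly_prod)
  have "poly (L i) (m j) = poly Q (m j) / (m j - d i)" for i
    using ne[of i] by (simp add: L_def Q_def poly_prod prod.remove[of UNIV i] divide_simps)
      (simp add: algebra_simps)
  then have "(\<Sum>i\<in>UNIV. w i * poly (L i) (m j)) = poly Q (m j) * (\<Sum>i\<in>UNIV. w i / (m j - d i))"
    by (simp add: sum_distrib_left mult.commute)
  with * have "poly Q (m j) * 1 = poly Q (m j) * (\<Sum>i\<in>UNIV. w i / (m j - d i))"
    by (metis mult.right_neutral)
  then show ?thesis using Q0 unfolding w_def by (metis mult_cancel_left)
qed

section \<open>Eigenvalues and eigenvectors of perturbed diagonal matrices\<close>

text \<open>The unperturbed determinant changes sign across its simple zero \<open>d i\<close>. By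
  continuity in \<open>e\<close> the sign change survives small perturbations, and the intermediate
  value theorem in \<open>t\<close> then provides a zero.\<close>

lemma det_pencil_IVT:
  fixes E :: "real^'a^'a" and d :: "'a \<Rightarrow> real"
  assumes "inj d" "0 < \<eta>"
  shows "\<forall>\<^sub>F e in at_right 0. \<exists>t. \<bar>t - d i\<bar> \<le> \<eta> \<and>
           det ((\<chi> a b. (if a = b then d a else 0) + e * E $ a $ b) - mat t) = 0"
proof -
  define g where "g e t = det ((\<chi> a b. (if a = b then d a else 0) + e * E $ a $ b) - mat t)" for e t
  have g0: "g 0 t = (\<Prod>a\<in>UNIV. d a - t)" for t
    unfolding g_def by (subst det_diagonal) (auto simp: mat_def)
  have gt: "continuous_on X (g e)" for X e
  proof -
    have *: "continuous_on X (\<lambda>t. if a = b then t else 0)" for a b :: 'a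
      by (cases "a = b") auto
    show ?thesis
      unfolding g_def det_def mat_def by (simp, intro continuous_intros *)
  qed
  have ge: "isCont (\<lambda>e. g e t) 0" for t
    unfolding g_def det_def by (simp, intro continuous_intros)
  \<comment> \<open>With \<open>r\<close> below every gap from \<open>d i\<close>, the product of
    the values at \<open>d i - r\<close> and \<open>d i + r\<close> has factors
    \<open>(d a - d i)\<^sup>2 - r\<^sup>2\<close>, of which only the one at \<open>a = i\<close> is
    negative.\<close>
  obtain r where r: "0 < r" "r \<le> \<eta>" "\<And>k. k \<noteq> i \<Longrightarrow> r < \<bar>d k - d i\<bar>"
  proof -
    have "\<forall>\<^sub>F r in at_right 0. \<forall>k\<in>UNIV - {i}. r < \<bar>d k - d i\<bar>"
    proof (intro eventually_ball_finite ballI)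
      fix k assume "k \<in> UNIV - {i}"
      then have "0 < \<bar>d k - d i\<bar>" using assms(1) by (auto dest: injD)
      then show "\<forall>\<^sub>F r in at_right 0. r < \<bar>d k - d i\<bar>"
        by (rule eventually_at_right_real[THEN eventually_mono]) auto
    qed simp
    moreover have "\<forall>\<^sub>F r in at_right 0. 0 < r \<and> r \<le> \<eta>"
      using eventually_at_right_real[OF assms(2)] by eventually_elim auto
    ultimately have "\<forall>\<^sub>F r in at_right 0. 0 < r \<and> r \<le> \<eta> \<and> (\<forall>k\<in>UNIV - {i}. r < \<bar>d k - d i\<bar>)"
      by eventually_elim auto
    then obtain r where "0 < r \<and> r \<le> \<eta> \<and> (\<forall>k\<in>UNIV - {i}. r < \<bar>d k - d i\<bar>)"
      using eventually_happens'[OF trivial_limit_at_right_real] by blast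
    then show ?thesis using that by blast
  qed
  have neg: "g 0 (d i - r) * g 0 (d i + r) < 0"
  proof -
    have "g 0 (d i - r) * g 0 (d i + r) = (\<Prod>a\<in>UNIV. (d a - d i + r) * (d a - d i - r))"
      by (simp add: g0 prod.distrib[symmetric] algebra_simps)
    also have "\<dots> = - (r * r) * (\<Prod>a\<in>UNIV-{i}. (d a - d i)\<^sup>2 - r\<^sup>2)"
      by (simp add: prod.remove[of UNIV i] power2_eq_square algebra_simps)
    also have "\<dots> < 0"
    proof -
      have "(\<Prod>a\<in>UNIV-{i}. (d a - d i)\<^sup>2 - r\<^sup>2) > 0"
      proof (rule prod_pos)
        fix a assume "a \<in> UNIV - {i}"
        then have "\<bar>r\<bar> < \<bar>d a - d i\<bar>" using r by auto
        then show "0 < (d a - d i)\<^sup>2 - r\<^sup>2" by (simp add: abs_le_square_iff[symmetric] not_le[symmetric] del: not_le)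
      qed
      then show ?thesis using r(1) by (simp add: mult_neg_pos)
    qed
    finally show ?thesis .
  qed
  have "((\<lambda>e. g e (d i - r) * g e (d i + r)) \<longlongrightarrow> g 0 (d i - r) * g 0 (d i + r)) (at_right 0)"
    using ge by (intro tendsto_mult) (auto simp: isCont_def intro: tendsto_within_subset)
  then have "\<forall>\<^sub>F e in at_right 0. g e (d i - r) * g e (d i + r) < 0"
    using neg by (rule order_tendstoD)
  then show ?thesis
  proof eventually_elim
    case (elim e)
    have "\<exists>t. d i - r \<le> t \<and> t \<le> d i + r \<and> g e t = 0"
    proof (cases "g e (d i - r) < 0")
      case True
      then have "0 < g e (d i + r)" using elim by (simp add: mult_less_0_iff)
      then show ?thesis using IVT'[of "g e" "d i - r" 0 "d i + r"] True gt r(1) by auto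
    next
      case False
      then have "g e (d i + r) < 0" "0 < g e (d i - r)" using elim by (auto simp: mult_less_0_iff)
      then show ?thesis using IVT2'[of "g e" "d i + r" 0 "d i - r"] gt r(1) by auto
    qed
    then obtain t where t: "d i - r \<le> t" "t \<le> d i + r" "g e t = 0" by blast
    then have "\<bar>t - d i\<bar> \<le> \<eta>" using r(2) by linarith
    then show ?case using t(3) unfolding g_def by blast
  qed
qed

text \<open>Normalising the length and the sign of coordinate \<open>i\<close> makes eigenvectors of
  nearby matrices converge to the standard basis vector instead of oscillating between it and its
  negative.\<close>

lemma singular_imp_eigenvector:
  fixes A :: "real^'a^'a"
  assumes "det (A - mat t) = 0"
  obtains u where "norm u = 1" "A *v u = t *\<^sub>R u" "0 \<le> u $ i"
proof -
  have "\<not> invertible (A - mat t)" using assms by (simp add: invertible_det_nz)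
  then obtain x where x: "x \<noteq> 0" "(A - mat t) *v x = 0"
    using matrix_left_invertible_ker[of "A - mat t"] invertible_left_inverse[of "A - mat t"] by blast
  have "mat t *v x = t *\<^sub>R x"
    by (simp add: matrix_vector_mult_def mat_def vec_eq_iff if_distrib[of "\<lambda>z. z * _"] cong: if_cong)
  then have Ax: "A *v x = t *\<^sub>R x"
    using x(2) by (simp add: matrix_vector_mult_diff_rdistrib)
  define s where "s = (if 0 \<le> x $ i then 1 / norm x else - 1 / norm x)"
  show ?thesis
  proof
    show "norm (s *\<^sub>R x) = 1" using x(1) by (simp add: s_def)
    show "A *v (s *\<^sub>R x) = t *\<^sub>R (s *\<^sub>R x)"
      using Ax by (simp add: matrix_vector_mult_scaleR)
    show "0 \<le> (s *\<^sub>R x) $ i" by (auto simp: s_def divide_nonpos_nonneg)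
  qed
qed

lemma diagonal_plus_mult_nth:
  "((\<chi> a b. (if a = b then d a else 0) + F a b) *v x) $ a = d a * x $ a + (\<Sum>b\<in>UNIV. F a b * x $ b)"
  for d :: "'a::finite \<Rightarrow> real"
  by (simp add: matrix_vector_mult_def distrib_right sum.distrib if_distrib[of "\<lambda>z. z * _"] cong: if_cong)

text \<open>The bound \<open>1 / Suc m\<close> on both the perturbation and the eigenvalue error
  forces the eigenvalues to the distinct entries of \<open>d\<close>, and the eigenvectors follow.
  Orthogonality holds once the eigenvalues have separated.\<close>

lemma perturbed_diagonal_eigenbasis:
  fixes E :: "real^'a^'a" and d :: "'a \<Rightarrow> real"
  assumes d: "inj d" and E: "transpose E = E"
  shows "\<exists>(e :: nat \<Rightarrow> real) A u t.
    (\<forall>m. 0 < e m) \<and>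
    (\<forall>m. A m = (\<chi> a b. (if a = b then d a else 0) + e m * E $ a $ b)) \<and>
    (\<forall>m i. A m *v u m i = t m i *\<^sub>R u m i) \<and>
    (\<forall>i. (\<lambda>m. t m i) \<longlonglongrightarrow> d i) \<and>
    (\<forall>i a. (\<lambda>m. u m i $ a) \<longlonglongrightarrow> (if i = a then 1 else 0)) \<and>
    (\<forall>\<^sub>F m in sequentially. \<forall>i j. u m i \<bullet> u m j = (if i = j then 1 else 0))"
proof -
  define B where "B e = (\<chi> a b. (if a = b then d a else 0) + e * E $ a $ b)" for e
  have "\<exists>e. (0 < e \<and> e < 1 / real (Suc m)) \<and>
          (\<forall>i. \<exists>t. \<bar>t - d i\<bar> \<le> 1 / real (Suc m) \<and> det (B e - mat t) = 0)" for m
  proof -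
    have pos: "0 < 1 / real (Suc m)" by simp
    have "\<forall>\<^sub>F e in at_right 0. \<forall>i. \<exists>t. \<bar>t - d i\<bar> \<le> 1 / real (Suc m) \<and> det (B e - mat t) = 0"
      unfolding B_def by (intro eventually_all_finite det_pencil_IVT[OF d pos])
    moreover have "\<forall>\<^sub>F e in at_right 0. 0 < e \<and> e < 1 / real (Suc m)"
      using eventually_at_right_real[OF pos] by eventually_elim simp
    ultimately show ?thesis
      using eventually_happens'[OF trivial_limit_at_right_real] eventually_conj by blast
  qed
  then obtain e where e: "\<And>m. 0 < e m \<and> e m < 1 / real (Suc m)"
    and ex_t: "\<And>m i. \<exists>t. \<bar>t - d i\<bar> \<le> 1 / real (Suc m) \<and> det (B (e m) - mat t) = 0"
    by metis
  define t where "t m i = (SOME t. \<bar>t - d i\<bar> \<le> 1 / real (Suc m) \<and> det (B (e m) - mat t) = 0)" for m i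
  have t: "\<bar>t m i - d i\<bar> \<le> 1 / real (Suc m) \<and> det (B (e m) - mat (t m i)) = 0" for m i
    unfolding t_def by (rule someI_ex[OF ex_t])
  have "\<exists>u. norm u = 1 \<and> B (e m) *v u = t m i *\<^sub>R u \<and> 0 \<le> u $ i" for m i
    using singular_imp_eigenvector t by metis
  then obtain u where u: "\<And>m i. norm (u m i) = 1 \<and> B (e m) *v u m i = t m i *\<^sub>R u m i \<and> 0 \<le> u m i $ i"
    by metis
  have lim0: "(\<lambda>m. 1 / real (Suc m)) \<longlonglongrightarrow> 0"
    using LIMSEQ_inverse_real_of_nat by (simp add: inverse_eq_divide)
  have e0: "e \<longlonglongrightarrow> 0"
    by (rule tendsto_sandwich[OF _ _ tendsto_const lim0]) (use e in \<open>auto intro!: always_eventually less_imp_le simp del: of_nat_Suc\<close>)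
  have tl: "(\<lambda>m. t m i) \<longlonglongrightarrow> d i" for i
    by (rule LIM_zero_cancel, rule Lim_null_comparison[OF _ lim0]) (use t in auto)
  have off: "(\<lambda>m. u m i $ a) \<longlonglongrightarrow> 0" if "i \<noteq> a" for i a
  proof -
    \<comment> \<open>This is row \<open>a\<close> of the eigenvector equation. The right side tends
      to 0, as \<open>u m i\<close> has norm 1, while the factor \<open>t m i - d a\<close> tends to
      the nonzero gap \<open>d i - d a\<close>.\<close>
    have eq: "(t m i - d a) * u m i $ a = e m * (E *v u m i) $ a" for m
    proof -
      have "(B (e m) *v u m i) $ a = d a * u m i $ a + e m * (E *v u m i) $ a"
        unfolding B_def diagonal_plus_mult_nth
        by (simp add: matrix_vector_mult_def sum_distrib_left mult.assoc)
      then show ?thesis using u[of m i] by (simp add: algebra_simps)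
    qed
    have "\<bar>(E *v u m i) $ a\<bar> \<le> onorm ((*v) E)" for m
    proof -
      have "\<bar>(E *v u m i) $ a\<bar> \<le> norm (E *v u m i)" by (rule component_le_norm_cart)
      also have "\<dots> \<le> onorm ((*v) E) * norm (u m i)"
        by (rule onorm) (rule matrix_vector_mul_bounded_linear)
      finally show ?thesis using u by simp
    qed
    then have "\<forall>\<^sub>F m in sequentially. norm (e m * (E *v u m i) $ a) \<le> \<bar>e m\<bar> * onorm ((*v) E)"
      by (simp add: abs_mult mult_left_mono)
    moreover have "(\<lambda>m. \<bar>e m\<bar> * onorm ((*v) E)) \<longlonglongrightarrow> 0"
      using tendsto_mult_right[OF tendsto_rabs[OF e0]] by simp
    ultimately have "(\<lambda>m. e m * (E *v u m i) $ a) \<longlonglongrightarrow> 0"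
      by (rule Lim_null_comparison)
    moreover have ne: "d i - d a \<noteq> 0" using that d by (auto dest: injD)
    moreover have tda: "(\<lambda>m. t m i - d a) \<longlonglongrightarrow> d i - d a" by (intro tendsto_intros tl)
    ultimately have "(\<lambda>m. e m * (E *v u m i) $ a / (t m i - d a)) \<longlonglongrightarrow> 0 / (d i - d a)"
      by (intro tendsto_divide)
    moreover have "\<forall>\<^sub>F m in sequentially. e m * (E *v u m i) $ a / (t m i - d a) = u m i $ a"
      using tendsto_imp_eventually_ne[OF tda ne]
      by eventually_elim (simp add: eq[symmetric])
    ultimately show ?thesis by (simp add: tendsto_cong)
  qed
  have diag: "(\<lambda>m. u m i $ i) \<longlonglongrightarrow> 1" for i
  proof -
    \<comment> \<open>Unit norm and the sign choice determine coordinate \<open>i\<close> from the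
      others.\<close>
    have "u m i $ i = sqrt (1 - (\<Sum>a\<in>UNIV-{i}. (u m i $ a)\<^sup>2))" for m
    proof -
      have "(norm (u m i))\<^sup>2 = (\<Sum>a\<in>UNIV. (u m i $ a)\<^sup>2)"
        by (simp only: power2_norm_eq_inner) (simp add: inner_vec_def power2_eq_square)
      then have "1 = (u m i $ i)\<^sup>2 + (\<Sum>a\<in>UNIV-{i}. (u m i $ a)\<^sup>2)"
        using u[of m i] by (simp add: sum.remove[of UNIV i])
      then have "1 - (\<Sum>a\<in>UNIV-{i}. (u m i $ a)\<^sup>2) = (u m i $ i)\<^sup>2" by simp
      then show ?thesis using u[of m i] by simp
    qed
    moreover have "(\<lambda>m. sqrt (1 - (\<Sum>a\<in>UNIV-{i}. (u m i $ a)\<^sup>2)))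
        \<longlonglongrightarrow> sqrt (1 - (\<Sum>a\<in>UNIV-{i}. 0\<^sup>2))"
      by (intro tendsto_intros off) auto
    ultimately show ?thesis by simp
  qed
  have Bsym: "transpose (B x) = B x" for x
    using E by (auto simp: B_def transpose_def vec_eq_iff)
  have ev: "\<forall>\<^sub>F m in sequentially. \<forall>i j. i \<noteq> j \<longrightarrow> t m i \<noteq> t m j"
  proof (intro eventually_all_finite)
    fix i j
    show "\<forall>\<^sub>F m in sequentially. i \<noteq> j \<longrightarrow> t m i \<noteq> t m j"
    proof (cases "i = j")
      case False
      then have "d i - d j \<noteq> 0" using d by (auto dest: injD)
      from tendsto_imp_eventually_ne[OF tendsto_diff[OF tl[of i] tl[of j]] this]
      show ?thesis by eventually_elim simp
    qed simp
  qed
  show ?thesis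
  proof (intro exI conjI allI)
    show "0 < e m" for m using e by blast
    show "B (e m) = (\<chi> a b. (if a = b then d a else 0) + e m * E $ a $ b)" for m
      by (simp add: B_def)
    show "B (e m) *v u m i = t m i *\<^sub>R u m i" for m i using u by blast
    show "(\<lambda>m. t m i) \<longlonglongrightarrow> d i" for i by (rule tl)
    show "(\<lambda>m. u m i $ a) \<longlonglongrightarrow> (if i = a then 1 else 0)" for i a
      using off diag by auto
    show "\<forall>\<^sub>F m in sequentially. \<forall>i j. u m i \<bullet> u m j = (if i = j then 1 else 0)"
      using ev
    proof eventually_elim
      case (elim m)
      have "u m i \<bullet> u m i = 1" for i
        using u[of m i] by (simp add: power2_norm_eq_inner[symmetric])
      moreover have "u m i \<bullet> u m j = 0" if "i \<noteq> j" for i j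
        using eigenvectors_orthogonal[OF Bsym] u elim that by blast
      ultimately show ?case by simp
    qed
  qed
qed

section \<open>Rank-one updates with an interlacing spectrum\<close>

text \<open>The standard eigenvector of a rank-one update: the inverse of \<open>m j\<close> times
  the identity minus diag d, applied to the vector z with entries
  \<open>sqrt (secular_weight d m i)\<close>.\<close>

definition secular_vector :: "('a::finite \<Rightarrow> real) \<Rightarrow> ('a \<Rightarrow> real) \<Rightarrow> 'a \<Rightarrow> real^'a" where
  "secular_vector d m j = (\<chi> i. sqrt (secular_weight d m i) / (m j - d i))"

text \<open>Up to a simultaneous reordering, \<open>d 1 < m 1 < d 2 < m 2 < \<dots>\<close>.\<close>

definition interlacing :: "('a \<Rightarrow> real) \<Rightarrow> ('a \<Rightarrow> real) \<Rightarrow> bool" where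
  "interlacing d m \<longleftrightarrow>
     (\<forall>i. d i < m i) \<and> (\<forall>i k. i \<noteq> k \<longrightarrow> 0 < (d i - m k) * (d i - d k))"

lemma interlacing_distinct:
  assumes "interlacing d m"
  shows "inj d" "inj m" "m j \<noteq> d i"
proof -
  have pos: "0 < (d i - m k) * (d i - d k)" if "i \<noteq> k" for i k
    using assms that by (simp add: interlacing_def)
  show "inj d" using pos by (metis injI diff_self mult_zero_right less_irrefl)
  have less': "d i < m i" for i using assms by (simp add: interlacing_def)
  show "m j \<noteq> d i" using pos[of i j] less'[of i] by (cases "i = j") auto
  \<comment> \<open>The sign condition places \<open>m i\<close> on the same side of
    \<open>d k\<close> as \<open>d i\<close>, so \<open>m\<close> inherits the order of
    \<open>d\<close>.\<close>
  have less: "m i < m k" if "d i < d k" for i k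
  proof -
    have "m i < d k"
      using pos[of k i] that by (cases "k = i") (auto simp: zero_less_mult_iff)
    also have "d k < m k" by (rule less')
    finally show ?thesis .
  qed
  show "inj m"
    by (rule injI) (metis less \<open>inj d\<close> injD less_irrefl linorder_neqE_linordered_idom)
qed

text \<open>Each factor is a quotient of two numbers of equal sign by interlacing. Positivity is
  what makes the product of \<open>sqrt (secular_weight d m i)\<close> with itself equal to the
  weight.\<close>

lemma secular_weight_pos:
  assumes "interlacing d m"
  shows "0 < secular_weight d m i"
proof -
  have "0 < (d i - m k) / (d i - d k)" if "k \<noteq> i" for k
    using assms that by (simp add: interlacing_def zero_less_mult_iff zero_less_divide_iff)
  then have "0 < (\<Prod>k\<in>UNIV-{i}. (d i - m k) / (d i - d k))"
    by (intro prod_pos) simp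
  then show ?thesis using assms by (simp add: secular_weight_def interlacing_def)
qed

text \<open>The secular equation says that the inner product of z with this vector is 1, so
  coordinate \<open>i\<close> reduces to an identity of fractions with denominator
  \<open>m j - d i\<close>.\<close>

lemma secular_vector_eigen:
  assumes "interlacing d m"
  shows "(\<chi> i k. (if i = k then d i else 0) + sqrt (secular_weight d m i) * sqrt (secular_weight d m k))
           *v secular_vector d m j = m j *\<^sub>R secular_vector d m j"
proof (rule vec_eq_iff[THEN iffD2], rule allI)
  fix i
  let ?z = "\<lambda>i. sqrt (secular_weight d m i)"
  have "((\<chi> i k. (if i = k then d i else 0) + ?z i * ?z k) *v secular_vector d m j) $ i
      = d i * (?z i / (m j - d i)) + ?z i * (\<Sum>k\<in>UNIV. ?z k * (?z k / (m j - d k)))"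
    unfolding diagonal_plus_mult_nth
    by (simp add: secular_vector_def sum_distrib_left mult.assoc)
  also have "(\<Sum>k\<in>UNIV. ?z k * (?z k / (m j - d k))) = 1"
    using secular_equation[where d = d and m = m and j = j] interlacing_distinct[OF assms]
    by (simp add: abs_of_pos[OF secular_weight_pos[OF assms]])
  also have "d i * (?z i / (m j - d i)) + ?z i * 1 = m j * (?z i / (m j - d i))"
    using interlacing_distinct(3)[OF assms, of j i] by (simp add: field_simps)
  finally show "((\<chi> i k. (if i = k then d i else 0) + ?z i * ?z k) *v secular_vector d m j) $ i
      = (m j *\<^sub>R secular_vector d m j) $ i"
    by (simp add: secular_vector_def)
qed

lemma secular_vector_nth_nonzero:
  assumes "interlacing d m"
  shows "secular_vector d m j $ i \<noteq> 0"
  using secular_weight_pos[OF assms, of i] interlacing_distinct(3)[OF assms, of j i]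
  by (simp add: secular_vector_def)

text \<open>Interlacing of the limits keeps every denominator away from 0.\<close>

lemma secular_vector_tendsto:
  assumes "\<And>i. ((\<lambda>x. d x i) \<longlongrightarrow> d0 i) F" "\<And>i. ((\<lambda>x. m x i) \<longlongrightarrow> m0 i) F"
    and "interlacing d0 m0"
  shows "((\<lambda>x. secular_vector (d x) (m x) j) \<longlongrightarrow> secular_vector d0 m0 j) F"
  unfolding secular_vector_def secular_weight_def
  using interlacing_distinct[OF assms(3)]
  by (intro tendsto_vec_lambda tendsto_intros assms(1,2)) (auto dest: injD)

text \<open>Interlacing consists of finitely many strict inequalities, an open condition.\<close>

lemma interlacing_eventually:
  fixes d0 m0 :: "'a::finite \<Rightarrow> real"
  assumes "\<And>i. ((\<lambda>x. d x i) \<longlongrightarrow> d0 i) F" "\<And>i. ((\<lambda>x. m x i) \<longlongrightarrow> m0 i) F"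
    and "interlacing d0 m0"
  shows "\<forall>\<^sub>F x in F. interlacing (d x) (m x)"
proof -
  have "\<forall>\<^sub>F x in F. \<forall>i. 0 < m x i - d x i"
    using assms(3)
    by (intro eventually_all_finite order_tendstoD(1)[OF tendsto_diff[OF assms(2,1)]])
      (simp add: interlacing_def)
  moreover have "\<forall>\<^sub>F x in F. \<forall>i k. i \<noteq> k \<longrightarrow> 0 < (d x i - m x k) * (d x i - d x k)"
  proof (intro eventually_all_finite)
    fix i k
    have "((\<lambda>x. (d x i - m x k) * (d x i - d x k)) \<longlongrightarrow> (d0 i - m0 k) * (d0 i - d0 k)) F"
      by (intro tendsto_intros assms)
    then show "\<forall>\<^sub>F x in F. i \<noteq> k \<longrightarrow> 0 < (d x i - m x k) * (d x i - d x k)"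
      using assms(3) by (cases "i = k") (auto simp: interlacing_def dest: order_tendstoD(1))
  qed
  ultimately show ?thesis
    by eventually_elim (simp add: interlacing_def)
qed

text \<open>These are normalised eigenvectors of one symmetric matrix for the distinct eigenvalues
  \<open>m j\<close>; \<open>sgn\<close> divides a vector by its norm.\<close>

lemma secular_basis_orthonormal:
  assumes "interlacing d m"
  shows "sgn (secular_vector d m i) \<bullet> sgn (secular_vector d m j) = (if i = j then 1 else 0)"
proof (cases "i = j")
  case True
  have "secular_vector d m i \<noteq> 0"
    using secular_vector_nth_nonzero[OF assms, of i i] by auto
  then show ?thesis
    using True by (simp add: power2_norm_eq_inner[symmetric] norm_sgn)
next
  case False
  have "secular_vector d m i \<bullet> secular_vector d m j = 0"
    by (rule eigenvectors_orthogonal[OF _ secular_vector_eigen[OF assms] secular_vector_eigen[OF assms]])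
      (use False interlacing_distinct(2)[OF assms] in
        \<open>auto simp: transpose_def vec_eq_iff mult.commute dest: injD\<close>)
  then show ?thesis using False by (simp add: sgn_div_norm)
qed

section \<open>Factorisations built from two orthonormal bases\<close>

text \<open>The vectors \<open>y a\<close> are the rows of Y = V diag(sqrt m) R^T, where V and R
  have columns \<open>v j\<close> and \<open>r j\<close>. Since V^T V = I, it follows that Y^T Y = R
  diag(m) R^T.\<close>

lemma frame_operator_of_decomposition:
  fixes v :: "'b::finite \<Rightarrow> real^'b" and r :: "'b \<Rightarrow> real^'a"
  assumes "\<And>i j. v i \<bullet> v j = (if i = j then 1 else 0)" and "\<And>j. 0 \<le> m j"
  defines "y \<equiv> \<lambda>a. \<Sum>j\<in>UNIV. (sqrt (m j) * v j $ a) *\<^sub>R r j"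
  shows "(\<Sum>a\<in>UNIV. (y a \<bullet> x) *\<^sub>R y a) = (\<Sum>j\<in>UNIV. (m j * (r j \<bullet> x)) *\<^sub>R r j)"
proof -
  have "(\<Sum>a\<in>UNIV. (y a \<bullet> x) *\<^sub>R y a)
      = (\<Sum>a\<in>UNIV. \<Sum>j\<in>UNIV. \<Sum>k\<in>UNIV.
          (sqrt (m j) * sqrt (m k) * (r k \<bullet> x) * (v j $ a * v k $ a)) *\<^sub>R r j)"
    by (simp add: y_def inner_sum_left sum_distrib_left scaleR_sum_left scaleR_sum_right mult_ac)
  also have "\<dots> = (\<Sum>j\<in>UNIV. \<Sum>k\<in>UNIV. \<Sum>a\<in>UNIV.
          (sqrt (m j) * sqrt (m k) * (r k \<bullet> x) * (v j $ a * v k $ a)) *\<^sub>R r j)"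
    by (subst sum.swap) (intro sum.cong refl sum.swap)
  also have "\<dots> = (\<Sum>j\<in>UNIV. \<Sum>k\<in>UNIV.
          (sqrt (m j) * sqrt (m k) * (r k \<bullet> x) * (v j \<bullet> v k)) *\<^sub>R r j)"
    by (simp add: inner_vec_def scaleR_sum_left sum_distrib_left)
  also have "\<dots> = (\<Sum>j\<in>UNIV. (m j * (r j \<bullet> x)) *\<^sub>R r j)"
    using assms(1,2)
    by (simp add: if_distrib[of "\<lambda>z. z *\<^sub>R _"] if_distrib[of "\<lambda>z. _ * z"] cong: if_cong)
  finally show ?thesis .
qed

text \<open>The companion product for the same Y: R^T R = I gives Y Y^T = V diag(m) V^T.\<close>

lemma gram_of_decomposition:
  fixes v :: "'b::finite \<Rightarrow> real^'b" and r :: "'b \<Rightarrow> real^'a"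
  assumes "\<And>i j. r i \<bullet> r j = (if i = j then 1 else 0)" and "\<And>j. 0 \<le> m j"
  defines "y \<equiv> \<lambda>a. \<Sum>j\<in>UNIV. (sqrt (m j) * v j $ a) *\<^sub>R r j"
  shows "y a \<bullet> y b = (\<Sum>j\<in>UNIV. m j * v j $ a * v j $ b)"
proof -
  have "y a \<bullet> y b = (\<Sum>j\<in>UNIV. \<Sum>k\<in>UNIV. sqrt (m j) * v j $ a * (sqrt (m k) * v k $ b * (r j \<bullet> r k)))"
    unfolding y_def inner_sum_left by (simp add: inner_sum_right sum_distrib_left mult_ac)
  also have "\<dots> = (\<Sum>j\<in>UNIV. sqrt (m j) * v j $ a * (sqrt (m j) * v j $ b))"
    by (simp add: assms(1) if_distrib[of "\<lambda>z. _ * z"] cong: if_cong)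
  also have "\<dots> = (\<Sum>j\<in>UNIV. (sqrt (m j) * sqrt (m j)) * v j $ a * v j $ b)"
    by (simp only: mult_ac)
  finally show ?thesis using assms(2) by simp
qed

section \<open>The Gram matrix of the join\<close>

lemma graph_join_iff [simp]:
  "(Inl a, Inl a') \<in> graph_join G G' \<longleftrightarrow> (a, a') \<in> G"
  "(Inr b, Inr b') \<in> graph_join G G' \<longleftrightarrow> (b, b') \<in> G'"
  "(Inl a, Inr b) \<in> graph_join G G'"
  "(Inr b, Inl a) \<in> graph_join G G'"
  by (auto simp: graph_join_def)

lemma gram_in_graph_matrices_join:
  fixes x :: "'a::finite \<Rightarrow> real^'n" and y :: "'b::finite \<Rightarrow> real^'n"
  assumes "\<And>a a'. a \<noteq> a' \<Longrightarrow> x a \<bullet> x a' \<noteq> 0 \<longleftrightarrow> (a, a') \<in> G"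
    and "\<And>b b'. b \<noteq> b' \<Longrightarrow> y b \<bullet> y b' \<noteq> 0 \<longleftrightarrow> (b, b') \<in> G'"
    and "\<And>a b. x a \<bullet> y b \<noteq> 0"
  shows "(\<chi> p q. case_sum x y p \<bullet> case_sum x y q) \<in> graph_matrices (graph_join G G')"
proof -
  have "case_sum x y p \<bullet> case_sum x y q \<noteq> 0 \<longleftrightarrow> (p, q) \<in> graph_join G G'" if "p \<noteq> q" for p q
    using assms that by (cases p; cases q) (auto simp: inner_commute)
  then show ?thesis
    by (simp add: graph_matrices_def transpose_def vec_eq_iff inner_commute)
qed

definition adjacency :: "('v::finite \<times> 'v) set \<Rightarrow> real^'v^'v" where
  "adjacency E = (\<chi> a b. if (a, b) \<in> E then 1 else 0)"

lemma transpose_adjacency: "simple_graph E \<Longrightarrow> transpose (adjacency E) = adjacency E"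
  by (auto simp: adjacency_def transpose_def vec_eq_iff simple_graph_def sym_def)

lemma join_gram_matrix_exists:
  fixes G :: "('a::finite \<times> 'a) set" and G' :: "('b::finite \<times> 'b) set" and \<iota> :: "'b \<Rightarrow> 'a"
  assumes G: "simple_graph G" and G': "simple_graph G'"
    and \<iota>: "inj \<iota>" and a0: "a0 \<notin> range \<iota>"
  shows "\<exists>M\<in>graph_matrices (graph_join G G'). q_matrix M \<le> 2 + (CARD('a) - CARD('b))"
proof -
  obtain h0 where h0: "bij_betw h0 (UNIV :: 'a set) {0..<CARD('a)}"
    using ex_bij_betw_finite_nat[of "UNIV :: 'a set"] by auto
  \<comment> \<open>An injective numbering in which only \<open>a0\<close> gets 0, so that
    \<open>\<mu>0\<close> vanishes exactly at \<open>a0\<close>.\<close>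
  define h where "h a = (if a = a0 then 0 else Suc (h0 a))" for a
  have h: "inj h" using h0 by (auto simp: inj_def h_def bij_betw_def)
  have h_le: "h a \<le> CARD('a)" for a
    using bij_betwE[OF h0, rule_format, of a] by (auto simp: h_def)
  \<comment> \<open>The constants make \<open>c - l0 a = 2 * h a - 1\<close> and
    \<open>\<mu>0 a = 2 * h a\<close>, so odd and even integers interlace; \<open>c\<close> is large
    enough for \<open>l0\<close> to be positive.\<close>
  define c where "c = real (2 * CARD('a) + 2)"
  define l0 where "l0 a = c + 1 - 2 * real (h a)" for a
  define \<mu>0 where "\<mu>0 a = 2 * real (h a)" for a
  have l0_pos: "0 < l0 a" for a
  proof -
    have "real (h a) \<le> real CARD('a)" using h_le by (rule of_nat_mono)
    then show ?thesis by (simp add: l0_def c_def)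
  qed
  define H where "H = map_prod \<iota> \<iota> ` G'"
  have H: "simple_graph H"
    using G' \<iota> by (fastforce simp: H_def simple_graph_def sym_def irrefl_def dest: injD)
  have H_iff: "(\<iota> b, \<iota> b') \<in> H \<longleftrightarrow> (b, b') \<in> G'" for b b'
    using \<iota> by (auto simp: H_def dest: injD)
  have inj0: "inj l0" "inj \<mu>0"
    using h by (auto simp: l0_def \<mu>0_def inj_def)
  obtain e A u l where "(\<forall>m. 0 < e m) \<and>
    (\<forall>m. A m = (\<chi> a b. (if a = b then l0 a else 0) + e m * adjacency G $ a $ b)) \<and>
    (\<forall>m i. A m *v u m i = l m i *\<^sub>R u m i) \<and>
    (\<forall>i. (\<lambda>m. l m i) \<longlonglongrightarrow> l0 i) \<and>
    (\<forall>i a. (\<lambda>m. u m i $ a) \<longlonglongrightarrow> (if i = a then 1 else 0)) \<and>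
    (\<forall>\<^sub>F m in sequentially. \<forall>i j. u m i \<bullet> u m j = (if i = j then 1 else 0))"
    using perturbed_diagonal_eigenbasis[OF inj0(1) transpose_adjacency[OF G]] by (elim exE)
  then have A: "\<And>m. 0 < e m"
      "\<And>m. A m = (\<chi> a b. (if a = b then l0 a else 0) + e m * adjacency G $ a $ b)"
      "\<And>m i. A m *v u m i = l m i *\<^sub>R u m i"
      "\<And>i. (\<lambda>m. l m i) \<longlonglongrightarrow> l0 i"
      "\<And>i a. (\<lambda>m. u m i $ a) \<longlonglongrightarrow> (if i = a then 1 else 0)"
      "\<forall>\<^sub>F m in sequentially. \<forall>i j. u m i \<bullet> u m j = (if i = j then 1 else 0)"
    by blast+
  obtain e' C v \<mu> where "(\<forall>m. 0 < e' m) \<and>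
    (\<forall>m. C m = (\<chi> a b. (if a = b then \<mu>0 a else 0) + e' m * adjacency H $ a $ b)) \<and>
    (\<forall>m i. C m *v v m i = \<mu> m i *\<^sub>R v m i) \<and>
    (\<forall>i. (\<lambda>m. \<mu> m i) \<longlonglongrightarrow> \<mu>0 i) \<and>
    (\<forall>i a. (\<lambda>m. v m i $ a) \<longlonglongrightarrow> (if i = a then 1 else 0)) \<and>
    (\<forall>\<^sub>F m in sequentially. \<forall>i j. v m i \<bullet> v m j = (if i = j then 1 else 0))"
    using perturbed_diagonal_eigenbasis[OF inj0(2) transpose_adjacency[OF H]] by (elim exE)
  then have C: "\<And>m. 0 < e' m"
      "\<And>m. C m = (\<chi> a b. (if a = b then \<mu>0 a else 0) + e' m * adjacency H $ a $ b)"
      "\<And>m i. C m *v v m i = \<mu> m i *\<^sub>R v m i"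
      "\<And>i. (\<lambda>m. \<mu> m i) \<longlonglongrightarrow> \<mu>0 i"
      "\<And>i a. (\<lambda>m. v m i $ a) \<longlonglongrightarrow> (if i = a then 1 else 0)"
      "\<forall>\<^sub>F m in sequentially. \<forall>i j. v m i \<bullet> v m j = (if i = j then 1 else 0)"
    by blast+
  define \<delta> where "\<delta> m i = c - l m i" for m i
  define r where "r m j = sgn (secular_vector (\<delta> m) (\<mu> m) j)" for m j
  \<comment> \<open>Rows of X and Y. The standard basis on the right of X makes X^T X = diag(l); the
    basis \<open>r\<close> on the right of Y makes Y^T Y the rank-one update of diag(\<delta>). Both
    hold once \<open>m\<close> is large.\<close>
  define x where "x m a = (\<Sum>i\<in>UNIV. (sqrt (l m i) * u m i $ a) *\<^sub>R axis i (1::real))" for m a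
  define y where "y m a = (\<Sum>j\<in>UNIV. (sqrt (\<mu> m j) * v m j $ a) *\<^sub>R r m j)" for m a
  define \<delta>0 where "\<delta>0 i = c - l0 i" for i
  have il0: "interlacing \<delta>0 \<mu>0"
    unfolding interlacing_def
  proof (intro conjI allI impI)
    show "\<delta>0 i < \<mu>0 i" for i by (simp add: \<delta>0_def \<mu>0_def l0_def)
    fix i k :: 'a assume "i \<noteq> k"
    then have "h i \<noteq> h k" using h by (auto dest: injD)
    then consider "real (h i) + 1 \<le> real (h k)" | "real (h k) + 1 \<le> real (h i)" by linarith
    then show "0 < (\<delta>0 i - \<mu>0 k) * (\<delta>0 i - \<delta>0 k)"
      by cases (auto simp: \<delta>0_def \<mu>0_def l0_def intro: mult_neg_neg mult_pos_pos)
  qed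
  have \<delta>_lim: "(\<lambda>m. \<delta> m i) \<longlonglongrightarrow> \<delta>0 i" for i
    unfolding \<delta>_def \<delta>0_def by (intro tendsto_intros A)
  have ev_il: "\<forall>\<^sub>F m in sequentially. interlacing (\<delta> m) (\<mu> m)"
    by (rule interlacing_eventually[OF \<delta>_lim C(4) il0])
  have ev_l: "\<forall>\<^sub>F m in sequentially. \<forall>i. 0 < l m i"
    by (intro eventually_all_finite order_tendstoD(1)[OF A(4)] l0_pos)
  have ev_\<mu>: "\<forall>\<^sub>F m in sequentially. \<forall>j. 0 \<le> \<mu> m j"
  proof (intro eventually_all_finite)
    fix j
    show "\<forall>\<^sub>F m in sequentially. 0 \<le> \<mu> m j"
    proof (cases "j = a0")
      case False
      then have "0 < \<mu>0 j" by (simp add: \<mu>0_def h_def)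
      from order_tendstoD(1)[OF C(4) this] show ?thesis by eventually_elim simp
    next
      case True
      \<comment> \<open>Here the limit \<open>\<mu>0 a0\<close> is 0 and decides no sign. But row
        \<open>a0\<close> of \<open>C m\<close> is zero, so \<open>\<mu> m a0\<close> is exactly 0
        as soon as \<open>v m a0 $ a0\<close>, which tends to 1, is nonzero.\<close>
      have "(C m *v v m a0) $ a0 = 0" for m
        unfolding C(2) diagonal_plus_mult_nth
        using a0 by (auto simp: \<mu>0_def h_def adjacency_def H_def intro!: sum.neutral)
      then have prod: "\<mu> m a0 * v m a0 $ a0 = 0" for m by (simp add: C(3))
      have "\<forall>\<^sub>F m in sequentially. v m a0 $ a0 \<noteq> 0"
        using tendsto_imp_eventually_ne[OF C(5)[of a0 a0]] by simp
      then show ?thesis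
      proof eventually_elim
        case (elim m)
        then show ?case using prod[of m] True by simp
      qed
    qed
  qed
  have xy: "x m a \<bullet> y m b = (\<Sum>i\<in>UNIV. \<Sum>j\<in>UNIV.
      sqrt (l m i) * u m i $ a * (sqrt (\<mu> m j) * v m j $ b * r m j $ i))" for m a b
    unfolding x_def y_def inner_sum_left
    by (simp add: inner_sum_right inner_axis' sum_distrib_left mult_ac)
  have ev_xy: "\<forall>\<^sub>F m in sequentially. \<forall>a b. x m a \<bullet> y m (\<iota> b) \<noteq> 0"
  proof (intro eventually_all_finite)
    fix a b
    define r0 where "r0 j = sgn (secular_vector \<delta>0 \<mu>0 j)" for j
    have nz: "secular_vector \<delta>0 \<mu>0 j \<noteq> 0" for j
      using secular_vector_nth_nonzero[OF il0, of j j] by auto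
    have r_lim: "(\<lambda>m. r m j $ i) \<longlonglongrightarrow> r0 j $ i" for i j
      unfolding r_def r0_def
      by (intro tendsto_vec_nth tendsto_sgn secular_vector_tendsto[OF \<delta>_lim C(4) il0] nz)
    \<comment> \<open>Both eigenbases tend to the standard basis, so the double sum collapses to the
      single term \<open>i = a\<close>, \<open>j = \<iota> b\<close>. It is nonzero because secular
      vectors have no zero entry and \<open>\<iota> b\<close> differs from
      \<open>a0\<close>.\<close>
    have "(\<lambda>m. x m a \<bullet> y m (\<iota> b)) \<longlonglongrightarrow> (\<Sum>i\<in>UNIV. \<Sum>j\<in>UNIV. sqrt (l0 i) * (if i = a then 1 else 0) *
        (sqrt (\<mu>0 j) * (if j = \<iota> b then 1 else 0) * r0 j $ i))"
      unfolding xy by (intro tendsto_intros A C r_lim)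
    also have "(\<Sum>i\<in>UNIV. \<Sum>j\<in>UNIV. sqrt (l0 i) * (if i = a then 1 else 0) *
        (sqrt (\<mu>0 j) * (if j = \<iota> b then 1 else 0) * r0 j $ i))
      = sqrt (l0 a) * (sqrt (\<mu>0 (\<iota> b)) * r0 (\<iota> b) $ a)"
      by (simp add: if_distrib[of "\<lambda>z. _ * z"] if_distrib[of "\<lambda>z. z * _"] cong: if_cong)
    finally have lim: "(\<lambda>m. x m a \<bullet> y m (\<iota> b)) \<longlonglongrightarrow> sqrt (l0 a) * (sqrt (\<mu>0 (\<iota> b)) * r0 (\<iota> b) $ a)" .
    have "0 < \<mu>0 (\<iota> b)" using a0 by (auto simp: \<mu>0_def h_def)
    moreover have "r0 (\<iota> b) $ a \<noteq> 0"
      using secular_vector_nth_nonzero[OF il0, of "\<iota> b" a] nz[of "\<iota> b"]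
      by (simp add: r0_def sgn_div_norm)
    ultimately show "\<forall>\<^sub>F m in sequentially. x m a \<bullet> y m (\<iota> b) \<noteq> 0"
      using l0_pos[of a] by (intro tendsto_imp_eventually_ne[OF lim]) simp
  qed
  obtain m where u: "\<And>i j. u m i \<bullet> u m j = (if i = j then 1 else 0)"
    and v: "\<And>i j. v m i \<bullet> v m j = (if i = j then 1 else 0)"
    and il: "interlacing (\<delta> m) (\<mu> m)" and l: "\<And>i. 0 \<le> l m i" and \<mu>: "\<And>j. 0 \<le> \<mu> m j"
    and xy_ne: "\<And>a b. x m a \<bullet> y m (\<iota> b) \<noteq> 0"
  proof -
    have "\<forall>\<^sub>F m in sequentially. (\<forall>i j. u m i \<bullet> u m j = (if i = j then 1 else 0)) \<and>
        (\<forall>i j. v m i \<bullet> v m j = (if i = j then 1 else 0)) \<and> interlacing (\<delta> m) (\<mu> m) \<and>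
        (\<forall>i. 0 < l m i) \<and> (\<forall>j. 0 \<le> \<mu> m j) \<and> (\<forall>a b. x m a \<bullet> y m (\<iota> b) \<noteq> 0)"
      by (intro eventually_conj A(6) C(6) ev_il ev_l ev_\<mu> ev_xy)
    then obtain m where "(\<forall>i j. u m i \<bullet> u m j = (if i = j then 1 else 0)) \<and>
        (\<forall>i j. v m i \<bullet> v m j = (if i = j then 1 else 0)) \<and> interlacing (\<delta> m) (\<mu> m) \<and>
        (\<forall>i. 0 < l m i) \<and> (\<forall>j. 0 \<le> \<mu> m j) \<and> (\<forall>a b. x m a \<bullet> y m (\<iota> b) \<noteq> 0)"
      using eventually_happens'[OF sequentially_bot] by blast
    then show ?thesis using that[of m] by (simp add: less_imp_le)
  qed
  have r: "r m i \<bullet> r m j = (if i = j then 1 else 0)" for i j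
    unfolding r_def by (rule secular_basis_orthonormal[OF il])
  have axis: "axis i (1::real) \<bullet> axis j 1 = (if i = j then 1 else 0)" for i j :: 'a
    by (simp add: inner_axis_axis)
  have xx: "x m a \<bullet> x m b = A m $ a $ b" for a b
    unfolding x_def orthonormal_eigen_decomposition[OF u A(3)]
    by (rule gram_of_decomposition[OF axis l])
  have yy: "y m a \<bullet> y m b = C m $ a $ b" for a b
    unfolding y_def orthonormal_eigen_decomposition[OF v C(3)]
    by (rule gram_of_decomposition[OF r \<mu>])
  have "(\<chi> p q. case_sum (x m) (\<lambda>b. y m (\<iota> b)) p \<bullet> case_sum (x m) (\<lambda>b. y m (\<iota> b)) q)
      \<in> graph_matrices (graph_join G G')"
  proof (rule gram_in_graph_matrices_join)
    show "x m a \<bullet> x m a' \<noteq> 0 \<longleftrightarrow> (a, a') \<in> G" if "a \<noteq> a'" for a a'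
      using that A(1)[of m] by (simp add: xx A(2) adjacency_def)
    show "y m (\<iota> b) \<bullet> y m (\<iota> b') \<noteq> 0 \<longleftrightarrow> (b, b') \<in> G'" if "b \<noteq> b'" for b b'
      using that C(1)[of m] \<iota> by (auto simp: yy C(2) adjacency_def H_iff dest: injD)
    show "x m a \<bullet> y m (\<iota> b) \<noteq> 0" for a b by (rule xy_ne)
  qed
  moreover have "q_matrix (\<chi> p q. case_sum (x m) (\<lambda>b. y m (\<iota> b)) p \<bullet> case_sum (x m) (\<lambda>b. y m (\<iota> b)) q)
      \<le> 2 + (CARD('a) - CARD('b))"
  proof (rule gram_eigenvalues_card)
    define z where "z = (\<chi> i. sqrt (secular_weight (\<delta> m) (\<mu> m) i))"
    \<comment> \<open>The deleted rows of Y that can be nonzero. Leaving out \<open>a0\<close> saves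
      one dimension, which \<open>z\<close> takes up, so the total stays at most
      \<open>CARD('a) - CARD('b)\<close>.\<close>
    define X where "X = - range \<iota> - {a0}"
    let ?B = "insert z (y m ` X)"
    show "finite ?B" by simp
    have "card X = CARD('a) - CARD('b) - 1"
      using a0 \<iota> by (simp add: X_def card_Diff_singleton card_image Compl_eq_Diff_UNIV card_Diff_subset)
    moreover have "CARD('b) < CARD('a)"
      using psubset_card_mono[of UNIV "range \<iota>"] a0 card_image[OF \<iota>] by (metis finite psubsetI top_greatest UNIV_I)
    ultimately show "card ?B \<le> CARD('a) - CARD('b)"
      using card_insert_le_m1[of "CARD('a) - CARD('b)" "y m ` X" z] card_image_le[of X "y m"] by simp
    fix w :: "real^'a"
    have y0: "y m a0 = 0"
    proof -
      have "y m a0 \<bullet> y m a0 = 0"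
        unfolding yy C(2) using a0 by (auto simp: \<mu>0_def h_def adjacency_def H_def)
      then show ?thesis by simp
    qed
    have sx: "(\<Sum>a\<in>UNIV. (x m a \<bullet> w) *\<^sub>R x m a) = (\<chi> i. l m i * w $ i)"
      unfolding x_def frame_operator_of_decomposition[OF u l]
      by (simp add: vec_eq_iff inner_axis') (simp add: axis_def if_distrib[of "\<lambda>z. _ * z"] cong: if_cong)
    have eigen: "(\<chi> i k. (if i = k then \<delta> m i else 0) + z $ i * z $ k) *v r m j = \<mu> m j *\<^sub>R r m j" for j
      using secular_vector_eigen[OF il, of j]
      by (simp add: z_def r_def sgn_div_norm matrix_vector_mult_scaleR)
    \<comment> \<open>The frame operator of the \<open>y m a\<close> is the spectral decomposition,
      in the basis \<open>r m\<close>, of the rank-one update; it is read backwards to recover that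
      matrix.\<close>
    have sy: "(\<Sum>a\<in>UNIV. (y m a \<bullet> w) *\<^sub>R y m a) = (\<chi> i. \<delta> m i * w $ i) + (z \<bullet> w) *\<^sub>R z"
    proof (rule vec_eq_iff[THEN iffD2], rule allI)
      fix i
      have "(\<Sum>a\<in>UNIV. (y m a \<bullet> w) *\<^sub>R y m a) $ i
          = (\<Sum>j\<in>UNIV. \<Sum>k\<in>UNIV. \<mu> m j * r m j $ i * r m j $ k * w $ k)"
        unfolding y_def frame_operator_of_decomposition[OF v \<mu>]
        by (simp add: inner_vec_def sum_distrib_left sum_distrib_right mult_ac)
      also have "\<dots> = (\<Sum>k\<in>UNIV. (\<Sum>j\<in>UNIV. \<mu> m j * r m j $ i * r m j $ k) * w $ k)"
        by (subst sum.swap) (simp add: sum_distrib_right)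
      also have "\<dots> = ((\<chi> i k. (if i = k then \<delta> m i else 0) + z $ i * z $ k) *v w) $ i"
        unfolding orthonormal_eigen_decomposition[OF r eigen, symmetric]
        by (simp add: matrix_vector_mult_def)
      also have "\<dots> = ((\<chi> i. \<delta> m i * w $ i) + (z \<bullet> w) *\<^sub>R z) $ i"
        unfolding diagonal_plus_mult_nth
        by (simp add: inner_vec_def sum_distrib_left mult_ac)
      finally show "(\<Sum>a\<in>UNIV. (y m a \<bullet> w) *\<^sub>R y m a) $ i
          = ((\<chi> i. \<delta> m i * w $ i) + (z \<bullet> w) *\<^sub>R z) $ i" .
    qed
    have split: "(\<Sum>a\<in>UNIV. (y m a \<bullet> w) *\<^sub>R y m a)
        = (\<Sum>b\<in>UNIV. (y m (\<iota> b) \<bullet> w) *\<^sub>R y m (\<iota> b)) + (\<Sum>a\<in>X. (y m a \<bullet> w) *\<^sub>R y m a)"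
    proof -
      have "(\<Sum>a\<in>UNIV. (y m a \<bullet> w) *\<^sub>R y m a)
          = (\<Sum>a\<in>range \<iota>. (y m a \<bullet> w) *\<^sub>R y m a) + (\<Sum>a\<in>- range \<iota>. (y m a \<bullet> w) *\<^sub>R y m a)"
        by (subst sum.union_disjoint[symmetric]) auto
      moreover have "(\<Sum>a\<in>- range \<iota>. (y m a \<bullet> w) *\<^sub>R y m a) = (\<Sum>a\<in>X. (y m a \<bullet> w) *\<^sub>R y m a)"
        using a0 by (simp add: X_def y0 sum.remove[of _ a0])
      ultimately show ?thesis by (simp add: sum.reindex[OF \<iota>])
    qed
    have "(\<Sum>q\<in>UNIV. (case_sum (x m) (\<lambda>b. y m (\<iota> b)) q \<bullet> w) *\<^sub>R case_sum (x m) (\<lambda>b. y m (\<iota> b)) q)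
        = (\<Sum>a\<in>UNIV. (x m a \<bullet> w) *\<^sub>R x m a) + (\<Sum>b\<in>UNIV. (y m (\<iota> b) \<bullet> w) *\<^sub>R y m (\<iota> b))"
      by (simp add: UNIV_Plus_UNIV[symmetric] sum.Plus del: UNIV_Plus_UNIV)
    also have "\<dots> = (\<Sum>a\<in>UNIV. (x m a \<bullet> w) *\<^sub>R x m a) + (\<Sum>a\<in>UNIV. (y m a \<bullet> w) *\<^sub>R y m a)
        - (\<Sum>a\<in>X. (y m a \<bullet> w) *\<^sub>R y m a)"
      by (simp add: split)
    \<comment> \<open>The diagonal parts add up to \<open>c\<close> since
      \<open>\<delta> m i = c - l m i\<close>.\<close>
    also have "\<dots> = c *\<^sub>R w + ((z \<bullet> w) *\<^sub>R z - (\<Sum>a\<in>X. (y m a \<bullet> w) *\<^sub>R y m a))"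
      unfolding sx sy by (simp add: vec_eq_iff \<delta>_def algebra_simps)
    finally have "(\<Sum>q\<in>UNIV. (case_sum (x m) (\<lambda>b. y m (\<iota> b)) q \<bullet> w) *\<^sub>R case_sum (x m) (\<lambda>b. y m (\<iota> b)) q) - c *\<^sub>R w
        = (z \<bullet> w) *\<^sub>R z - (\<Sum>a\<in>X. (y m a \<bullet> w) *\<^sub>R y m a)" by simp
    also have "\<dots> \<in> span ?B"
      by (intro span_diff span_mul span_sum) (auto intro: span_base)
    finally show "(\<Sum>q\<in>UNIV. (case_sum (x m) (\<lambda>b. y m (\<iota> b)) q \<bullet> w) *\<^sub>R case_sum (x m) (\<lambda>b. y m (\<iota> b)) q) - c *\<^sub>R w
        \<in> span ?B" .
  qed
  ultimately show ?thesis by blast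
qed

theorem theorem4p6:
  fixes G :: "('a::finite \<times> 'a) set" and G' :: "('b::finite \<times> 'b) set"
    and n l :: nat
  assumes "simple_graph G" and "simple_graph G'"
    and "connected_graph G" and "connected_graph G'"
    and "CARD('a) = n" and "CARD('b) = n - l"
    and "1 \<le> l" and "l < n"
  shows "q_graph (graph_join G G') \<le> 2 + l"
proof -
  fix a0 :: 'a
  \<comment> \<open>As \<open>l\<close> is at least 1, the vertices of \<open>G'\<close> fit among
    those of \<open>G\<close> other than \<open>a0\<close>.\<close>
  have "card (UNIV :: 'b set) \<le> card (UNIV - {a0})"
    using assms(5-8) by (simp add: card_Diff_singleton)
  then obtain \<iota> :: "'b \<Rightarrow> 'a" where "inj \<iota>" "range \<iota> \<subseteq> UNIV - {a0}"
    using card_le_inj[of "UNIV :: 'b set" "UNIV - {a0}"] by auto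
  then obtain M where M: "M \<in> graph_matrices (graph_join G G')" "q_matrix M \<le> 2 + (CARD('a) - CARD('b))"
    using join_gram_matrix_exists[OF assms(1,2), of \<iota> a0] by blast
  have "q_graph (graph_join G G') \<le> q_matrix M"
    unfolding q_graph_def using M(1) by (intro cINF_lower) auto
  then show ?thesis using M(2) assms(5-8) by simp
qed

end
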